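(* Let $\mathbb{K}$ be a semiring and $A$ a finite alphabet. Every $\mathbb{K}$-automaton over $A^*$ has a unique coarsest congruence, i.e. a congruence that is coarser than or equal to every congruence.
   Context: A $\mathbb{K}$-automaton of dimension $Q$ (a finite set) over $A^*$ is a triple $\mathcal{A}=\langle I,E,T\rangle$ with $I\in\mathbb{K}^Q$ a row vector, $T\in\mathbb{K}^Q$ a column vector, and $E\colon Q\times A\times Q\to\mathbb{K}$; for $a\in A$, $E_a$ denotes the $Q\times Q$ matrix $(E(p,a,q))_{p,q}$. For a surjective map $\varphi\colon Q\to R$, its amalgamation matrix $M_\varphi$ is the $Q\times R$ matrix with $(q,r)$ entry $1_{\mathbb{K}}$ if $\varphi(q)=r$ and $0_{\mathbb{K}}$ otherwise. Given $\mathcal{B}=\langle J,F,U\rangle$ of dimension $R$, a surjective $\varphi\colon Q\to R$ is a morphism from $\mathcal{A}$ onto $\mathcal{B}$ if $I M_\varphi=J$, $E_aM_\varphi=M_\varphi F_a$ for all $a\in A$, and $T=M_\varphi U$. A congruence on $Q$ is an equivalence on $Q$ that is the map equivalence (kernel) of some morphism from $\mathcal{A}$ onto some $\mathbb{K}$-automaton. An equivalence $\mathcal{R}$ is coarser than an equivalence $\mathcal{P}$ if every class of $\mathcal{P}$ is contained in some class of $\mathcal{R}$. *)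

theory Defs imports Main begin

(* The automaton data are total functions; only their values on the set of states
   and on the alphabet matter.  States and alphabet are explicit sets, so that both may be
   empty.  The sort {semiring_0, monoid_mult} used for the coefficients describes semirings
   with 0 and 1, not necessarily commutative, and, unlike semiring_1, does not impose 0 ~= 1. *)
record ('q, 'a, 'k) automaton =
  states :: "'q set"
  init :: "'q \<Rightarrow> 'k"
  weight :: "'q \<Rightarrow> 'a \<Rightarrow> 'q \<Rightarrow> 'k"
  final :: "'q \<Rightarrow> 'k"

definition is_automaton :: "('q, 'a, 'k::{semiring_0, monoid_mult}) automaton \<Rightarrow> bool" where
  "is_automaton \<A> \<longleftrightarrow> finite (states \<A>)"

definition trans_mat :: "('q, 'a, 'k) automaton \<Rightarrow> 'a \<Rightarrow> 'q \<Rightarrow> 'q \<Rightarrow> 'k" where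
  "trans_mat \<A> a = (\<lambda>p q. weight \<A> p a q)"

(* Row times matrix, matrix times matrix, and matrix times column; the set S is the common
   index set that is summed over. *)
definition row_mat :: "'i set \<Rightarrow> ('i \<Rightarrow> 'k::{semiring_0, monoid_mult}) \<Rightarrow> ('i \<Rightarrow> 'j \<Rightarrow> 'k) \<Rightarrow> 'j \<Rightarrow> 'k" where
  "row_mat S v M = (\<lambda>j. \<Sum>i\<in>S. v i * M i j)"

definition mat_mat :: "'j set \<Rightarrow> ('i \<Rightarrow> 'j \<Rightarrow> 'k::{semiring_0, monoid_mult}) \<Rightarrow> ('j \<Rightarrow> 'l \<Rightarrow> 'k) \<Rightarrow> 'i \<Rightarrow> 'l \<Rightarrow> 'k" where
  "mat_mat S M N = (\<lambda>i l. \<Sum>j\<in>S. M i j * N j l)"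

definition mat_col :: "'j set \<Rightarrow> ('i \<Rightarrow> 'j \<Rightarrow> 'k::{semiring_0, monoid_mult}) \<Rightarrow> ('j \<Rightarrow> 'k) \<Rightarrow> 'i \<Rightarrow> 'k" where
  "mat_col S M v = (\<lambda>i. \<Sum>j\<in>S. M i j * v j)"

definition amalg :: "('q \<Rightarrow> 'r) \<Rightarrow> 'q \<Rightarrow> 'r \<Rightarrow> 'k::{semiring_0, monoid_mult}" where
  "amalg \<phi> = (\<lambda>q r. if \<phi> q = r then 1 else 0)"

definition morphism :: "'a set \<Rightarrow> ('q, 'a, 'k::{semiring_0, monoid_mult}) automaton \<Rightarrow>
    ('r, 'a, 'k) automaton \<Rightarrow> ('q \<Rightarrow> 'r) \<Rightarrow> bool" where
  "morphism A \<A> \<B> \<phi> \<longleftrightarrow>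
     \<phi> ` states \<A> = states \<B> \<and>
     (\<forall>r\<in>states \<B>. row_mat (states \<A>) (init \<A>) (amalg \<phi>) r = init \<B> r) \<and>
     (\<forall>a\<in>A. \<forall>q\<in>states \<A>. \<forall>r\<in>states \<B>.
        mat_mat (states \<A>) (trans_mat \<A> a) (amalg \<phi>) q r =
        mat_mat (states \<B>) (amalg \<phi>) (trans_mat \<B> a) q r) \<and>
     (\<forall>q\<in>states \<A>. final \<A> q = mat_col (states \<B>) (amalg \<phi>) (final \<B>) q)"

definition map_equiv :: "'q set \<Rightarrow> ('q \<Rightarrow> 'r) \<Rightarrow> ('q \<times> 'q) set" where
  "map_equiv Q \<phi> = {(p, q). p \<in> Q \<and> q \<in> Q \<and> \<phi> p = \<phi> q}"

(* HOL cannot quantify over the type of states of the target.  As every finite set is in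
   bijection with a set of natural numbers, targets with states in nat suffice;
   congruence_map_equiv below shows that targets over any other type give nothing more. *)
definition congruence :: "'a set \<Rightarrow> ('q, 'a, 'k::{semiring_0, monoid_mult}) automaton \<Rightarrow>
    ('q \<times> 'q) set \<Rightarrow> bool" where
  "congruence A \<A> P \<longleftrightarrow>
     equiv (states \<A>) P \<and>
     (\<exists>(\<B> :: (nat, 'a, 'k) automaton) \<phi>.
        is_automaton \<B> \<and> morphism A \<A> \<B> \<phi> \<and> P = map_equiv (states \<A>) \<phi>)"

definition coarser_eq :: "'q set \<Rightarrow> ('q \<times> 'q) set \<Rightarrow> ('q \<times> 'q) set \<Rightarrow> bool" where
  "coarser_eq Q R P \<longleftrightarrow> (\<forall>C\<in>Q // P. \<exists>D\<in>Q // R. C \<subseteq> D)"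

lemma congruence_map_equiv:
  fixes \<A> :: "('q, 'a, 'k::{semiring_0, monoid_mult}) automaton"
    and \<B> :: "('r, 'a, 'k) automaton"
  assumes "is_automaton \<B>" and m: "morphism A \<A> \<B> \<phi>"
  shows "congruence A \<A> (map_equiv (states \<A>) \<phi>)"
proof -
  let ?Q = "states \<A>" and ?R = "states \<B>"
  obtain f :: "'r \<Rightarrow> nat" where f: "inj_on f ?R"
    using assms(1) finite_imp_inj_to_nat_seg unfolding is_automaton_def by metis
  define g where "g = the_inv_into ?R f"
  have g: "g (f r) = r" if "r \<in> ?R" for r
    using that f by (simp add: g_def the_inv_into_f_f)
  define \<C> :: "(nat, 'a, 'k) automaton" where
    "\<C> = \<lparr>states = f ` ?R, init = (\<lambda>n. init \<B> (g n)),
          weight = (\<lambda>m a n. weight \<B> (g m) a (g n)), final = (\<lambda>n. final \<B> (g n))\<rparr>"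
  have im: "\<phi> ` ?Q = ?R" using m by (simp add: morphism_def)
  have am: "amalg (f \<circ> \<phi>) q (f r) = (amalg \<phi> q r :: 'k)" if "q \<in> ?Q" "r \<in> ?R" for q r
    using that im f by (auto simp: amalg_def inj_on_def)
  have im': "(f \<circ> \<phi>) ` ?Q = f ` ?R"
    using im by (metis image_comp)
  have "morphism A \<A> \<C> (f \<circ> \<phi>)"
    using m im im'
    by (auto simp: morphism_def \<C>_def row_mat_def mat_mat_def mat_col_def trans_mat_def
        sum.reindex[OF f, unfolded o_def] am g simp del: o_apply cong: sum.cong)
  moreover have "is_automaton \<C>"
    using assms(1) by (simp add: is_automaton_def \<C>_def)
  moreover have "map_equiv ?Q (f \<circ> \<phi>) = map_equiv ?Q \<phi>"
    using im f by (auto simp: map_equiv_def inj_on_def)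
  moreover have "equiv ?Q (map_equiv ?Q \<phi>)"
    by (rule equivI) (auto simp: map_equiv_def refl_on_def sym_def trans_def)
  ultimately show ?thesis
    unfolding congruence_def by metis
qed

end

theory Submission imports Defs begin

text \<open>
  An equivalence \<open>P\<close> on the states is a congruence iff equivalent states have the same final
  value and, for each letter, the same total weight into each class of \<open>P\<close>. Let \<open>R\<close> be the
  transitive closure of the union of all congruences. A class of \<open>R\<close> is a union of classes of
  every congruence \<open>P\<close>, so states related by \<open>P\<close> have the same total weight into it; by
  transitivity so do states related by \<open>R\<close>. Hence \<open>R\<close> is itself a congruence.
\<close>

lemma sum_mult_amalg:
  fixes v :: "'q \<Rightarrow> 'k::{semiring_0, monoid_mult}"
  assumes "finite Q"
  shows "(\<Sum>i\<in>Q. v i * amalg \<phi> i r) = sum v {i \<in> Q. \<phi> i = r}"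
  using assms by (simp add: amalg_def if_distrib sum.inter_filter cong: if_cong)

lemma sum_amalg_mult:
  fixes v :: "'r \<Rightarrow> 'k::{semiring_0, monoid_mult}"
  assumes "finite S" "\<phi> q \<in> S"
  shows "(\<Sum>j\<in>S. amalg \<phi> q j * v j) = v (\<phi> q)"
proof -
  have "(\<Sum>j\<in>S. amalg \<phi> q j * v j) = (\<Sum>j\<in>S. if \<phi> q = j then v j else 0)"
    by (rule sum.cong) (auto simp: amalg_def)
  then show ?thesis using assms by simp
qed

text \<open>Multiplying by \<open>amalg \<phi>\<close> on the right adds up entries over the fibres
  of \<phi>; multiplying on the left selects the row indexed by \<open>\<phi> q\<close>. The latter
  needs \<open>\<phi> q\<close> to be a state of the target, hence the case split on surjectivity;
  when that fails, both sides are false.\<close>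

lemma morphism_iff:
  fixes \<A> :: "('q, 'a, 'k::{semiring_0, monoid_mult}) automaton"
  assumes "finite (states \<A>)"
  shows "morphism A \<A> \<B> \<phi> \<longleftrightarrow>
    \<phi> ` states \<A> = states \<B> \<and>
    (\<forall>r\<in>states \<B>. sum (init \<A>) {p \<in> states \<A>. \<phi> p = r} = init \<B> r) \<and>
    (\<forall>a\<in>A. \<forall>q\<in>states \<A>. \<forall>r\<in>states \<B>.
       sum (weight \<A> q a) {p \<in> states \<A>. \<phi> p = r} = weight \<B> (\<phi> q) a r) \<and>
    (\<forall>q\<in>states \<A>. final \<A> q = final \<B> (\<phi> q))"
proof (cases "\<phi> ` states \<A> = states \<B>")
  case True
  then have "finite (states \<B>)" "\<And>q. q \<in> states \<A> \<Longrightarrow> \<phi> q \<in> states \<B>"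
    using assms by (metis finite_imageI, blast)
  then show ?thesis
    using assms by (simp add: morphism_def row_mat_def mat_mat_def mat_col_def trans_mat_def
        sum_mult_amalg sum_amalg_mult)
qed (simp add: morphism_def)

text \<open>This describes congruences without mentioning a target. The initial vector is absent
  because the target can always take the class sums of \<open>init \<A>\<close> as its own.\<close>

lemma congruence_iff:
  fixes \<A> :: "('q, 'a, 'k::{semiring_0, monoid_mult}) automaton"
  assumes fin: "finite (states \<A>)"
  shows "congruence A \<A> P \<longleftrightarrow> equiv (states \<A>) P \<and>
    (\<forall>(p, q)\<in>P. final \<A> p = final \<A> q \<and>
       (\<forall>a\<in>A. \<forall>C\<in>states \<A> // P. sum (weight \<A> p a) C = sum (weight \<A> q a) C))"
    (is "_ \<longleftrightarrow> equiv ?Q P \<and> ?stable")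
proof
  assume "congruence A \<A> P"
  then obtain \<B> :: "(nat, 'a, 'k) automaton" and \<phi> where
    eq: "equiv ?Q P" and m: "morphism A \<A> \<B> \<phi>" and P: "P = map_equiv ?Q \<phi>"
    unfolding congruence_def by blast
  note m = m[unfolded morphism_iff[OF fin]]
  \<comment> \<open>Each class is a fibre of \<phi>, so the sum of the weights from \<open>p\<close>
    into it is an entry of \<B> that depends on \<open>p\<close> only through
    \<open>\<phi> p\<close>.\<close>
  have cl: "\<exists>r\<in>states \<B>. C = {p \<in> ?Q. \<phi> p = r}" if C: "C \<in> ?Q // P" for C
  proof -
    obtain x where "x \<in> ?Q" "C = P `` {x}" using C by (rule quotientE)
    then show ?thesis using m unfolding P map_equiv_def by (intro bexI[of _ "\<phi> x"]) auto
  qed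
  have "final \<A> p = final \<A> q" if "(p, q) \<in> P" for p q
    using that m unfolding P map_equiv_def by auto
  moreover have "sum (weight \<A> p a) C = sum (weight \<A> q a) C"
    if "(p, q) \<in> P" "a \<in> A" "C \<in> ?Q // P" for p q a C
    using cl[OF that(3)] that(1,2) m unfolding P map_equiv_def by auto
  ultimately show "equiv ?Q P \<and> ?stable" using eq by blast
next
  assume R: "equiv ?Q P \<and> ?stable"
  then have eq: "equiv ?Q P" by simp
  define rep where "rep C = (SOME p. p \<in> C)" for C :: "'q set"
  \<comment> \<open>The quotient automaton: by stability, the values read off at the chosen
    representative agree with those at every state of the class.\<close>
  define \<B> :: "('q set, 'a, 'k) automaton" where
    "\<B> = \<lparr>states = ?Q // P, init = sum (init \<A>),
          weight = (\<lambda>C a. sum (weight \<A> (rep C) a)), final = (\<lambda>C. final \<A> (rep C))\<rparr>"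
  define \<phi> where "\<phi> q = P `` {q}" for q
  have rep: "(q, rep (\<phi> q)) \<in> P" if "q \<in> ?Q" for q
    using equiv_class_self[OF eq that] unfolding rep_def \<phi>_def by (metis Image_singleton_iff someI)
  have fib: "{p \<in> ?Q. \<phi> p = C} = C" if C: "C \<in> ?Q // P" for C
  proof -
    obtain x where "x \<in> ?Q" "C = P `` {x}" using C by (rule quotientE)
    then show ?thesis
      using eq_equiv_class_iff[OF eq] equiv_type[OF eq] equiv_class_eq_iff[OF eq]
      unfolding \<phi>_def by auto
  qed
  have "morphism A \<A> \<B> \<phi>"
    unfolding morphism_iff[OF fin]
  proof (intro conjI ballI)
    show "\<phi> ` ?Q = states \<B>"
      by (auto simp: \<B>_def \<phi>_def quotient_def)
    show "sum (init \<A>) {p \<in> ?Q. \<phi> p = C} = init \<B> C" if "C \<in> states \<B>" for C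
      using that fib by (simp add: \<B>_def)
    show "sum (weight \<A> q a) {p \<in> ?Q. \<phi> p = C} = weight \<B> (\<phi> q) a C"
      if "a \<in> A" "q \<in> ?Q" "C \<in> states \<B>" for a q C
    proof -
      have "C \<in> ?Q // P" using that(3) by (simp add: \<B>_def)
      then show ?thesis using R rep[OF that(2)] that(1) by (fastforce simp: fib \<B>_def)
    qed
    show "final \<A> q = final \<B> (\<phi> q)" if "q \<in> ?Q" for q
      using R rep[OF that] by (fastforce simp: \<B>_def)
  qed
  moreover have "is_automaton \<B>"
    using fin equiv_type[OF eq] by (simp add: is_automaton_def \<B>_def finite_quotient)
  moreover have "map_equiv ?Q \<phi> = P"
    using eq_equiv_class_iff[OF eq] equiv_type[OF eq] by (auto simp: map_equiv_def \<phi>_def)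
  \<comment> \<open>The states of the quotient are sets; \<open>congruence_map_equiv\<close>
    replaces them by natural numbers.\<close>
  ultimately show "congruence A \<A> P"
    using congruence_map_equiv by metis
qed

text \<open>A class of \<open>R\<close> containing the \<open>P\<close>-class of \<open>p\<close>
  contains \<open>p\<close> and everything \<open>P\<close>-related to it. Uniqueness thereby
  reduces to antisymmetry of inclusion.\<close>

lemma coarser_eq_iff_subset:
  assumes P: "equiv Q P" and R: "equiv Q R"
  shows "coarser_eq Q R P \<longleftrightarrow> P \<subseteq> R"
proof
  assume c: "coarser_eq Q R P"
  show "P \<subseteq> R"
  proof clarify
    fix p q assume pq: "(p, q) \<in> P"
    then have p: "p \<in> Q" using equiv_type[OF P] by auto
    then obtain D where D: "D \<in> Q // R" "P `` {p} \<subseteq> D"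
      using c unfolding coarser_eq_def by (meson quotientI)
    then have "p \<in> D" "q \<in> D" using pq equiv_class_self[OF P p] by auto
    then show "(p, q) \<in> R" using quotient_eq_iff[OF R D(1) D(1)] by blast
  qed
next
  assume "P \<subseteq> R"
  then show "coarser_eq Q R P"
    unfolding coarser_eq_def quotient_def by blast
qed

text \<open>A set closed under \<open>P\<close> is the finite disjoint union of the classes of its
  elements, so its sum can be regrouped class by class.\<close>

lemma sum_eq_of_class_sums_eq:
  fixes f g :: "'q \<Rightarrow> 'k::comm_monoid_add"
  assumes fin: "finite Q" and P: "equiv Q P" and D: "D \<subseteq> Q" "P `` D \<subseteq> D"
    and eq: "\<And>C. C \<in> Q // P \<Longrightarrow> sum f C = sum g C"
  shows "sum f D = sum g D"
proof -
  let ?\<C> = "(\<lambda>x. P `` {x}) ` D"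
  have U: "\<Union>?\<C> = D" using D equiv_class_self[OF P] by blast
  have sub: "?\<C> \<subseteq> Q // P" using D by (auto intro: quotientI)
  have "sum h D = (\<Sum>C\<in>?\<C>. sum h C)" for h :: "'q \<Rightarrow> 'k"
  proof -
    have "\<forall>C\<in>?\<C>. finite C" using U D(1) fin by (metis Union_upper finite_subset)
    moreover have "\<forall>C\<in>?\<C>. \<forall>C'\<in>?\<C>. C \<noteq> C' \<longrightarrow> C \<inter> C' = {}"
      using sub quotient_disj[OF P] by blast
    ultimately show ?thesis using sum.Union_disjoint[of ?\<C> h] U by simp
  qed
  moreover have "(\<Sum>C\<in>?\<C>. sum f C) = (\<Sum>C\<in>?\<C>. sum g C)"
    by (rule sum.cong[OF refl]) (rule eq[OF subsetD[OF sub]])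
  ultimately show ?thesis by simp
qed

text \<open>Ensures that the union of all congruences relates every state to itself.\<close>

lemma congruence_Id_on:
  assumes "finite (states \<A>)"
  shows "congruence A \<A> (Id_on (states \<A>))"
  using assms
  by (auto simp: congruence_iff intro!: equivI refl_onI sym_Id_on trans_Id_on)

lemma congruence_join:
  fixes \<A> :: "('q, 'a, 'k::{semiring_0, monoid_mult}) automaton"
  assumes fin: "finite (states \<A>)"
  shows "congruence A \<A> ((\<Union>(Collect (congruence A \<A>)))\<^sup>+)" (is "congruence A \<A> (?U\<^sup>+)")
proof -
  let ?Q = "states \<A>"
  note iff = congruence_iff[OF fin]
  have cong_equiv: "equiv ?Q P" if "congruence A \<A> P" for P using that iff by blast
  have eq: "equiv ?Q (?U\<^sup>+)"
  proof (rule equivI)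
    have "?U \<subseteq> ?Q \<times> ?Q" using cong_equiv equiv_type by blast
    then show "?U\<^sup>+ \<subseteq> ?Q \<times> ?Q" by (rule trancl_subset_Sigma)
    have "Id_on ?Q \<subseteq> ?U" using congruence_Id_on[OF fin, of A] by blast
    then show "refl_on ?Q (?U\<^sup>+)" by (auto intro!: refl_onI)
    have "sym ?U" using cong_equiv by (intro sym_UNION[of _ id, simplified]) (blast elim: equivE)
    then show "sym (?U\<^sup>+)" by (rule sym_trancl)
  qed simp
  \<comment> \<open>The sums run over classes of the closure already here, not over classes of the
    single congruence relating \<open>p\<close> and \<open>q\<close>; this lets the equalities be
    chained.\<close>
  have one_step: "final \<A> p = final \<A> q \<and>
      (\<forall>a\<in>A. \<forall>D\<in>?Q // ?U\<^sup>+. sum (weight \<A> p a) D = sum (weight \<A> q a) D)"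
    if "(p, q) \<in> ?U" for p q
  proof -
    obtain P where P: "congruence A \<A> P" "(p, q) \<in> P" using \<open>(p, q) \<in> ?U\<close> by blast
    have "sum (weight \<A> p a) D = sum (weight \<A> q a) D" if "a \<in> A" and D: "D \<in> ?Q // ?U\<^sup>+" for a D
    proof (rule sum_eq_of_class_sums_eq[OF fin cong_equiv[OF P(1)]])
      show "D \<subseteq> ?Q" using D by (simp add: in_quotient_imp_subset[OF eq])
      show "P `` D \<subseteq> D"
        \<comment> \<open>\<open>P\<close> is contained in \<open>?U\<^sup>+\<close>, so a class of
          the closure is closed under \<open>P\<close>.\<close>
        using P(1) in_quotient_imp_closed[OF eq D] by blast
      show "sum (weight \<A> p a) C = sum (weight \<A> q a) C" if "C \<in> ?Q // P" for C
        using P \<open>a \<in> A\<close> that iff by blast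
    qed
    then show ?thesis using P iff by blast
  qed
  have "final \<A> p = final \<A> q \<and>
      (\<forall>a\<in>A. \<forall>D\<in>?Q // ?U\<^sup>+. sum (weight \<A> p a) D = sum (weight \<A> q a) D)"
    if "(p, q) \<in> ?U\<^sup>+" for p q
    using that
  proof (induction rule: trancl_induct)
    case (base q)
    then show ?case by (rule one_step)
  next
    case (step q r)
    then show ?case using one_step[OF step.hyps(2)] by simp
  qed
  then show ?thesis using eq iff by blast
qed

theorem theorem3p13:
  fixes A :: "'a set"
    and \<A> :: "('q, 'a, 'k::{semiring_0, monoid_mult}) automaton"
  assumes "finite A" and "is_automaton \<A>"
  shows "\<exists>!R. congruence A \<A> R \<and>
           (\<forall>P. congruence A \<A> P \<longrightarrow> coarser_eq (states \<A>) R P)"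
proof -
  have fin: "finite (states \<A>)" using assms(2) by (simp add: is_automaton_def)
  have iff: "coarser_eq (states \<A>) R P \<longleftrightarrow> P \<subseteq> R"
    if "congruence A \<A> R" "congruence A \<A> P" for R P
    using that coarser_eq_iff_subset unfolding congruence_def by blast
  let ?R = "(\<Union>(Collect (congruence A \<A>)))\<^sup>+"
  have R: "congruence A \<A> ?R" by (rule congruence_join[OF fin])
  have sub: "P \<subseteq> ?R" if "congruence A \<A> P" for P
    using that by (auto intro: r_into_trancl)
  show ?thesis
  proof (rule ex1I[of _ ?R])
    show "congruence A \<A> ?R \<and> (\<forall>P. congruence A \<A> P \<longrightarrow> coarser_eq (states \<A>) ?R P)"
      using R sub iff by blast
    \<comment> \<open>Two coarsest congruences contain each other.\<close>
    show "S = ?R" if "congruence A \<A> S \<and> (\<forall>P. congruence A \<A> P \<longrightarrow> coarser_eq (states \<A>) S P)" for S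
      using that R sub iff by (meson subset_antisym)
  qed
qed

end
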